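(* Let $R$ be self-adjoint on $\mathbb{C}^M$ with simple spectrum, and suppose some irreducible symmetric tridiagonal matrix $T$ (real, with nonzero off-diagonal entries) satisfies $[R,T]=0$. Then the commutant of $R$ within the set $\mathcal{T}$ of (real) symmetric tridiagonal $M\times M$ matrices is exactly $$\{A\in\mathcal{T}:[R,A]=0\}=\operatorname{span}\{\mathbf{I},T\}.$$ In particular every element of this commutant independent of $\mathbf{I}$ equals $\alpha T+\beta\mathbf{I}$ with $\alpha\ne0$; it has the eigenbasis of $T$ and, its spectrum being simple, recovers the eigenbasis uniquely as a Karhunen–Loève transform (KLT) of $R$.
   Context: $[X,Y]=XY-YX$. "Nonzero off-diagonal entries" refers to the entries $T_{i,i+1}=T_{i+1,i}$. $\operatorname{span}$ is the real linear span. A KLT of $R$ is an orthonormal eigenbasis of $R$; uniqueness is up to ordering and unit scalar factors. *)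

theory Defs
  imports
    "Jordan_Normal_Form.Schur_Decomposition"
    "Jordan_Normal_Form.Spectral_Radius"
    "HOL-Combinatorics.Permutations"
begin

definition commutator :: "'a :: ring_1 mat \<Rightarrow> 'a mat \<Rightarrow> 'a mat" where
  "commutator X Y = X * Y - Y * X"

text \<open>Real matrices acting on complex vectors.\<close>

abbreviation cmat :: "real mat \<Rightarrow> complex mat" where
  "cmat A \<equiv> map_mat complex_of_real A"

definition self_adjoint :: "complex mat \<Rightarrow> bool" where
  "self_adjoint A \<longleftrightarrow> square_mat A \<and> mat_adjoint A = A"

definition simple_spectrum :: "complex mat \<Rightarrow> bool" where
  "simple_spectrum A \<longleftrightarrow> (\<forall>k \<in> spectrum A. order k (char_poly A) = 1)"

definition sym_tridiagonal :: "nat \<Rightarrow> real mat set" where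
  "sym_tridiagonal n = {A \<in> carrier_mat n n. transpose_mat A = A \<and>
     (\<forall>i < n. \<forall>j < n. i + 1 < j \<or> j + 1 < i \<longrightarrow> A $$ (i, j) = 0)}"

definition irreducible_sym_tridiagonal :: "nat \<Rightarrow> real mat set" where
  "irreducible_sym_tridiagonal n =
     {A \<in> sym_tridiagonal n. \<forall>i. i + 1 < n \<longrightarrow> A $$ (i, i + 1) \<noteq> 0}"

abbreviation real_mat_span :: "nat \<Rightarrow> real mat set \<Rightarrow> real mat set" where
  "real_mat_span n \<equiv> LinearCombinations.module.span class_ring (module_mat TYPE(real) n n)"

text \<open>Linear independence of a pair: the library notion speaks about sets, so equality of the
  two matrices (which would collapse the pair to a singleton) is excluded separately.\<close>

definition independent_pair :: "nat \<Rightarrow> real mat \<Rightarrow> real mat \<Rightarrow> bool" where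
  "independent_pair n A B \<longleftrightarrow> A \<noteq> B \<and>
     \<not> LinearCombinations.module.lin_dep class_ring (module_mat TYPE(real) n n) {A, B}"

definition orthonormal_basis :: "nat \<Rightarrow> complex vec list \<Rightarrow> bool" where
  "orthonormal_basis n bs \<longleftrightarrow>
     VectorSpace.vectorspace.basis class_ring (module_vec TYPE(complex) n) (set bs) \<and>
     (\<forall>i < length bs. \<forall>j < length bs. bs ! i \<bullet>c bs ! j = (if i = j then 1 else 0))"

text \<open>A KLT of a self-adjoint \<open>R\<close> is an orthonormal eigenbasis of \<open>R\<close>.\<close>

definition orthonormal_eigenbasis :: "complex mat \<Rightarrow> complex vec list \<Rightarrow> bool" where
  "orthonormal_eigenbasis A bs \<longleftrightarrow>
     orthonormal_basis (dim_row A) bs \<and> (\<forall>b \<in> set bs. \<exists>k. eigenvector A b k)"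

abbreviation (input) is_KLT :: "complex mat \<Rightarrow> complex vec list \<Rightarrow> bool" where
  "is_KLT \<equiv> orthonormal_eigenbasis"

definition same_up_to_order_and_phase :: "complex vec list \<Rightarrow> complex vec list \<Rightarrow> bool" where
  "same_up_to_order_and_phase bs cs \<longleftrightarrow> length bs = length cs \<and>
     (\<exists>p c. p permutes {..<length bs} \<and>
        (\<forall>i < length bs. cmod (c i) = 1 \<and> cs ! i = c i \<cdot>\<^sub>v bs ! p i))"

end

theory Submission
  imports Defs
begin

text \<open>
  Let \<open>T\<close> be a matrix with nonzero superdiagonal and zeros above it. Reading \<open>(T x)\<^sub>i\<close> as an
  equation for \<open>x\<^sub>i\<^sub>+\<^sub>1\<close>, a \<open>T\<close>-invariant set of vectors with vanishing first coordinate consists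
  of zero only. Applied to an eigenspace of \<open>T\<close>, this shows that eigenspaces are lines; applied to
  the range of a matrix \<open>B\<close> that commutes with \<open>T\<close> and has zero first row, it gives \<open>B = 0\<close>.

  Since \<open>R\<close> has simple spectrum, everything commuting with \<open>R\<close> is diagonal in the eigenbasis of
  \<open>R\<close>; hence a tridiagonal \<open>A\<close> in the commutant commutes with \<open>T\<close>. Choosing \<open>\<alpha>\<close> and \<open>\<beta>\<close> so that
  \<open>A - \<alpha>T - \<beta>I\<close> has zero first row forces \<open>A = \<alpha>T + \<beta>I\<close>. When \<open>\<alpha> \<noteq> 0\<close>, \<open>A\<close> is again irreducible,
  so \<open>A\<close>, \<open>T\<close> and \<open>R\<close> commute pairwise with one-dimensional eigenspaces and share all eigenvectors.
\<close>

section \<open>Unreduced Hessenberg matrices\<close>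

lemma unreduced_hessenberg_invariant_zero:
  fixes T :: "'a :: idom mat"
  assumes T: "T \<in> carrier_mat n n"
    and upper: "\<And>i j. j < n \<Longrightarrow> i + 1 < j \<Longrightarrow> T $$ (i, j) = 0"
    and super: "\<And>i. i + 1 < n \<Longrightarrow> T $$ (i, i + 1) \<noteq> 0"
    and U: "U \<subseteq> carrier_vec n"
    and inv: "\<And>x. x \<in> U \<Longrightarrow> T *\<^sub>v x \<in> U"
    and first: "\<And>x. x \<in> U \<Longrightarrow> 0 < n \<Longrightarrow> x $ 0 = 0"
    and x: "x \<in> U"
  shows "x = 0\<^sub>v n"
proof -
  have "x \<in> U \<Longrightarrow> k < n \<Longrightarrow> x $ k = 0" for x k
  proof (induction k arbitrary: x rule: less_induct)
    case (less k)
    show ?case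
    proof (cases k)
      case 0
      then show ?thesis using first less.prems by simp
    next
      case (Suc i)
      have xc: "x \<in> carrier_vec n" using less.prems U by auto
      have i: "i + 1 < n" using Suc less.prems by simp
      \<comment> \<open>The induction hypothesis at \<open>i\<close> is applied to
        \<open>T *\<^sub>v x\<close>, which lies in \<open>U\<close> again; this is why
        \<open>x\<close> is generalised in the induction.\<close>
      have "0 = (T *\<^sub>v x) $ i"
        using less.IH[of i "T *\<^sub>v x"] inv less.prems Suc by simp
      also have "\<dots> = (\<Sum>j<n. T $$ (i, j) * x $ j)"
        using T xc i by (simp add: scalar_prod_def atLeast0LessThan)
      also have "\<dots> = (\<Sum>j\<in>{i + 1}. T $$ (i, j) * x $ j)"
      proof (rule sum.mono_neutral_right)
        show "\<forall>j\<in>{..<n} - {i + 1}. T $$ (i, j) * x $ j = 0"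
        proof
          fix j assume "j \<in> {..<n} - {i + 1}"
          then have j: "j < n" "j \<noteq> i + 1" by auto
          \<comment> \<open>With \<open>k = i + 1\<close>, coordinates before \<open>k\<close>
            vanish by induction, and entries of \<open>T\<close> beyond the superdiagonal vanish by
            shape.\<close>
          then consider "j < k" | "i + 1 < j" using Suc by linarith
          then show "T $$ (i, j) * x $ j = 0"
            using less.IH[of j x] less.prems upper[of j i] j by cases auto
        qed
      qed (use i in auto)
      finally show ?thesis using super[OF i] Suc by simp
    qed
  qed
  then show ?thesis using x U by (intro eq_vecI) auto
qed

text \<open>The usual meaning over a field: every eigenspace is at most a line. Comparing pairs of
  eigenvectors avoids speaking of the dimension of a kernel.\<close>

definition nonderogatory :: "'a :: comm_ring_1 mat \<Rightarrow> bool" where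
  "nonderogatory A \<longleftrightarrow>
     (\<forall>u v k. eigenvector A u k \<longrightarrow> eigenvector A v k \<longrightarrow> (\<exists>c. v = c \<cdot>\<^sub>v u))"

lemma nonderogatoryD:
  assumes "nonderogatory A" "eigenvector A u k" "eigenvector A v k"
  obtains c where "v = c \<cdot>\<^sub>v u"
  using assms unfolding nonderogatory_def by blast

text \<open>The first coordinate is an injective linear functional on each eigenspace.\<close>

lemma unreduced_hessenberg_nonderogatory:
  fixes T :: "'a :: field mat"
  assumes T: "T \<in> carrier_mat n n"
    and upper: "\<And>i j. j < n \<Longrightarrow> i + 1 < j \<Longrightarrow> T $$ (i, j) = 0"
    and super: "\<And>i. i + 1 < n \<Longrightarrow> T $$ (i, i + 1) \<noteq> 0"
  shows "nonderogatory T"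
  unfolding nonderogatory_def
proof (intro allI impI)
  fix u v k assume u: "eigenvector T u k" and v: "eigenvector T v k"
  have uc: "u \<in> carrier_vec n" "u \<noteq> 0\<^sub>v n" "T *\<^sub>v u = k \<cdot>\<^sub>v u"
    and vc: "v \<in> carrier_vec n" "T *\<^sub>v v = k \<cdot>\<^sub>v v"
    using u v T unfolding eigenvector_def by auto
  \<comment> \<open>The invariant set is the part of the \<open>k\<close>-eigenspace with vanishing
    first coordinate, on which \<open>T\<close> acts as \<open>k\<close>. The guard
    \<open>0 < n\<close> keeps the coordinate meaningful.\<close>
  have zero: "x = 0\<^sub>v n"
    if x: "x \<in> carrier_vec n" "T *\<^sub>v x = k \<cdot>\<^sub>v x" "0 < n \<Longrightarrow> x $ 0 = 0" for x
  proof (rule unreduced_hessenberg_invariant_zero[OF T upper super])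
    show "x \<in> {y \<in> carrier_vec n. T *\<^sub>v y = k \<cdot>\<^sub>v y \<and> (0 < n \<longrightarrow> y $ 0 = 0)}"
      using x by simp
    fix y assume "y \<in> {y \<in> carrier_vec n. T *\<^sub>v y = k \<cdot>\<^sub>v y \<and> (0 < n \<longrightarrow> y $ 0 = 0)}"
    then show "T *\<^sub>v y \<in> {y \<in> carrier_vec n. T *\<^sub>v y = k \<cdot>\<^sub>v y \<and> (0 < n \<longrightarrow> y $ 0 = 0)}"
      using T by (auto simp: mult_mat_vec)
  qed auto
  have u0: "0 < n" "u $ 0 \<noteq> 0" using zero[of u] uc by auto
  \<comment> \<open>This choice cancels the first coordinate of
    \<open>v - c \<cdot>\<^sub>v u\<close>; the denominator is nonzero because \<open>u\<close>
    is.\<close>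
  define c where "c = v $ 0 / u $ 0"
  have "v - c \<cdot>\<^sub>v u = 0\<^sub>v n"
  proof (rule zero)
    show "T *\<^sub>v (v - c \<cdot>\<^sub>v u) = k \<cdot>\<^sub>v (v - c \<cdot>\<^sub>v u)"
      using T uc vc
      by (auto simp: mult_minus_distrib_mat_vec mult_mat_vec algebra_simps intro!: eq_vecI)
    show "(v - c \<cdot>\<^sub>v u) $ 0 = 0" using uc vc u0 unfolding c_def by simp
  qed (use uc vc in simp)
  then have "v $ i = (c \<cdot>\<^sub>v u) $ i" if "i < n" for i
  proof -
    have "(v - c \<cdot>\<^sub>v u) $ i = 0"
      using \<open>v - c \<cdot>\<^sub>v u = 0\<^sub>v n\<close> that by simp
    then show ?thesis using that uc vc by simp
  qed
  then show "\<exists>c. v = c \<cdot>\<^sub>v u" using uc vc by (intro exI[of _ c] eq_vecI) auto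
qed

text \<open>By linearity, a matrix commuting with \<open>T\<close> is determined by its first row;
  the lemma is later applied to a difference.\<close>

lemma unreduced_hessenberg_commuting_zero:
  fixes T :: "'a :: idom mat"
  assumes T: "T \<in> carrier_mat n n"
    and upper: "\<And>i j. j < n \<Longrightarrow> i + 1 < j \<Longrightarrow> T $$ (i, j) = 0"
    and super: "\<And>i. i + 1 < n \<Longrightarrow> T $$ (i, i + 1) \<noteq> 0"
    and B: "B \<in> carrier_mat n n" and comm: "T * B = B * T"
    and row: "\<And>j. j < n \<Longrightarrow> B $$ (0, j) = 0"
  shows "B = 0\<^sub>m n n"
proof (rule eq_matI)
  fix i j assume ij: "i < dim_row (0\<^sub>m n n :: 'a mat)" "j < dim_col (0\<^sub>m n n :: 'a mat)"
  \<comment> \<open>Column \<open>j\<close> of \<open>B\<close> is an element of the range of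
    \<open>B\<close>, the invariant set used here.\<close>
  have "B *\<^sub>v unit_vec n j = 0\<^sub>v n"
  proof (rule unreduced_hessenberg_invariant_zero[OF T upper super])
    show "B *\<^sub>v unit_vec n j \<in> (\<lambda>x. B *\<^sub>v x) ` carrier_vec n" by auto
    show "(\<lambda>x. B *\<^sub>v x) ` carrier_vec n \<subseteq> carrier_vec n" using B by auto
    fix y assume "y \<in> (\<lambda>x. B *\<^sub>v x) ` carrier_vec n"
    then obtain x where x: "x \<in> carrier_vec n" "y = B *\<^sub>v x" by auto
    have "T *\<^sub>v y = B *\<^sub>v (T *\<^sub>v x)"
      using x T B comm by (metis assoc_mult_mat_vec)
    then show "T *\<^sub>v y \<in> (\<lambda>x. B *\<^sub>v x) ` carrier_vec n"
      using T x by auto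
    show "y $ 0 = 0" if "0 < n"
      using x B row that by (auto simp: scalar_prod_def)
  qed
  then have "(B *\<^sub>v unit_vec n j) $ i = 0" using ij by simp
  then show "B $$ (i, j) = 0\<^sub>m n n $$ (i, j)"
    using B ij by simp
qed (use B in auto)

section \<open>Commuting matrices and simple spectra\<close>

text \<open>\<open>B\<close> maps each eigenspace of \<open>A\<close> into itself, and a linear map
  of a line to itself is a scaling.\<close>

lemma commuting_eigenvector:
  fixes A B :: "'a :: field mat"
  assumes A: "A \<in> carrier_mat n n" and B: "B \<in> carrier_mat n n" and comm: "A * B = B * A"
    and lines: "nonderogatory A" and v: "eigenvector A v k"
  shows "\<exists>l. eigenvector B v l"
proof -
  have vc: "v \<in> carrier_vec n" "v \<noteq> 0\<^sub>v n" "A *\<^sub>v v = k \<cdot>\<^sub>v v"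
    using v A unfolding eigenvector_def by auto
  have Bv: "B *\<^sub>v v \<in> carrier_vec n" using B vc by simp
  have "A *\<^sub>v (B *\<^sub>v v) = B *\<^sub>v (A *\<^sub>v v)"
    using A B vc comm by (metis assoc_mult_mat_vec)
  also have "\<dots> = k \<cdot>\<^sub>v (B *\<^sub>v v)" unfolding vc(3) by (rule mult_mat_vec[OF B vc(1)])
  finally have "B *\<^sub>v v = 0\<^sub>v n \<or> eigenvector A (B *\<^sub>v v) k"
    using A Bv unfolding eigenvector_def by auto
  \<comment> \<open>If \<open>B\<close> kills \<open>v\<close>, its image is no eigenvector of
    \<open>A\<close> and the eigenvalue is \<open>l = 0\<close>.\<close>
  then obtain l where "B *\<^sub>v v = l \<cdot>\<^sub>v v"
  proof
    assume "B *\<^sub>v v = 0\<^sub>v n"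
    have "B *\<^sub>v v = 0 \<cdot>\<^sub>v v"
      unfolding \<open>B *\<^sub>v v = 0\<^sub>v n\<close> using vc(1) by (intro eq_vecI) auto
    then show thesis by (rule that)
  next
    assume "eigenvector A (B *\<^sub>v v) k"
    then show thesis using nonderogatoryD[OF lines v] that by blast
  qed
  then show ?thesis using vc B unfolding eigenvector_def by auto
qed

text \<open>Over the complex numbers the root orders of the characteristic polynomial sum to
  \<open>n\<close>, and each is at least 1. Hence all are 1 exactly when there are \<open>n\<close>
  roots.\<close>

lemma simple_spectrum_iff_card:
  assumes A: "A \<in> carrier_mat n n"
  shows "simple_spectrum A \<longleftrightarrow> card (spectrum A) = n"
proof -
  let ?p = "char_poly A"
  have p: "?p \<noteq> 0" "degree ?p = n" using degree_monic_char_poly[OF A] by auto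
  have S: "spectrum A = set_mset (proots ?p)"
    unfolding spectrum_root_char_poly[OF A] using p by simp
  have fin: "finite (spectrum A)" unfolding S by simp
  have sum: "n = (\<Sum>k\<in>spectrum A. order k ?p)"
    using size_proots_complex[of ?p] p by (simp add: size_multiset_overloaded_eq S)
  have pos: "1 \<le> order k ?p" if "k \<in> spectrum A" for k
    using that p order_root[of ?p k] unfolding spectrum_root_char_poly[OF A] by fastforce
  show ?thesis
  proof
    assume "simple_spectrum A"
    then show "card (spectrum A) = n"
      using sum unfolding simple_spectrum_def by simp
  next
    assume "card (spectrum A) = n"
    then have eq: "(\<Sum>k\<in>spectrum A. 1) = (\<Sum>k\<in>spectrum A. order k ?p)" using sum by simp
    have "1 = order k ?p" if "k \<in> spectrum A" for k
      by (rule sum_mono_inv[OF eq pos that fin])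
    then show "simple_spectrum A"
      unfolding simple_spectrum_def by auto
  qed
qed


section \<open>Orthonormal lists and bases\<close>

text \<open>The form of orthonormality suited to matrix computations: membership in the carrier
  replaces the basis property, which is recovered from length \<open>n\<close> in
  \<open>orthonormal_basis_iff\<close>.\<close>

definition orthonormal_list :: "nat \<Rightarrow> complex vec list \<Rightarrow> bool" where
  "orthonormal_list n bs \<longleftrightarrow> set bs \<subseteq> carrier_vec n \<and>
     (\<forall>i < length bs. \<forall>j < length bs. bs ! i \<bullet>c bs ! j = (if i = j then 1 else 0))"

lemma orthonormal_list_distinct:
  assumes "orthonormal_list n bs"
  shows "distinct bs"
proof (rule corthogonal_distinct, rule corthogonalI)
  fix i j assume "i < length bs" "j < length bs"
  then show "(bs ! i \<bullet>c bs ! j = 0) = (i \<noteq> j)"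
    using assms unfolding orthonormal_list_def by simp
qed

text \<open>\<open>Q\<close> is the adjoint of \<open>P\<close>, so \<open>Q * P\<close> is a Gram
  matrix and equals the identity; for square matrices a one-sided inverse is two-sided.\<close>

lemma orthonormal_list_unitary:
  assumes bs: "orthonormal_list n bs" and len: "length bs = n"
  defines "P \<equiv> mat_of_cols n bs" and "Q \<equiv> mat_of_rows n (map conjugate bs)"
  shows "P \<in> carrier_mat n n" "Q \<in> carrier_mat n n" "Q * P = 1\<^sub>m n" "P * Q = 1\<^sub>m n"
proof -
  show P: "P \<in> carrier_mat n n" and Q: "Q \<in> carrier_mat n n"
    unfolding P_def Q_def using len by auto
  have c: "bs ! i \<in> carrier_vec n" if "i < n" for i
    using bs that len unfolding orthonormal_list_def by force
  show QP: "Q * P = 1\<^sub>m n"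
  proof (rule eq_matI)
    fix i j assume ij: "i < dim_row (1\<^sub>m n :: complex mat)" "j < dim_col (1\<^sub>m n :: complex mat)"
    then have "(Q * P) $$ (i, j) = conjugate (bs ! i) \<bullet> bs ! j"
      unfolding P_def Q_def using len c by simp
    also have "\<dots> = bs ! j \<bullet>c bs ! i"
      using ij c by (intro conjugate_vec_sprod_comm[symmetric, of _ n]) auto
    finally show "(Q * P) $$ (i, j) = 1\<^sub>m n $$ (i, j)"
      using bs ij len unfolding orthonormal_list_def by auto
  qed (use P Q in auto)
  show "P * Q = 1\<^sub>m n" by (rule mat_mult_left_right_inverse[OF Q P QP])
qed

text \<open>The entries of \<open>?Q *\<^sub>v x\<close> are the inner products of \<open>x\<close>
  with the list, and multiplying by \<open>?P\<close> recovers \<open>x\<close>.\<close>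

lemma orthonormal_list_complete:
  assumes bs: "orthonormal_list n bs" and len: "length bs = n"
    and x: "x \<in> carrier_vec n" and orth: "\<And>b. b \<in> set bs \<Longrightarrow> x \<bullet>c b = 0"
  shows "x = 0\<^sub>v n"
proof -
  let ?P = "mat_of_cols n bs" and ?Q = "mat_of_rows n (map conjugate bs)"
  note PQ = orthonormal_list_unitary[OF bs len]
  have c: "bs ! i \<in> carrier_vec n" if "i < n" for i
    using bs that len unfolding orthonormal_list_def by force
  have "?Q *\<^sub>v x = 0\<^sub>v n"
  proof (rule eq_vecI)
    fix i assume i: "i < dim_vec (0\<^sub>v n :: complex vec)"
    then have "(?Q *\<^sub>v x) $ i = conjugate (bs ! i) \<bullet> x" using len c by simp
    also have "\<dots> = x \<bullet>c bs ! i"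
      using i c x by (intro conjugate_vec_sprod_comm[symmetric, of _ n]) auto
    finally show "(?Q *\<^sub>v x) $ i = 0\<^sub>v n $ i" using orth len i by simp
  qed (use PQ in auto)
  moreover have "?P *\<^sub>v 0\<^sub>v n = 0\<^sub>v n" using PQ(1) by (intro eq_vecI) auto
  ultimately have "?P *\<^sub>v (?Q *\<^sub>v x) = 0\<^sub>v n" by simp
  then show ?thesis using assoc_mult_mat_vec[OF PQ(1,2) x] PQ(4) x by simp
qed

text \<open>The hypothesis compares \<open>A * ?P\<close> and \<open>B * ?P\<close> column by
  column; the invertible factor \<open>?P\<close> then cancels.\<close>

lemma orthonormal_list_eq_matI:
  assumes bs: "orthonormal_list n bs" and len: "length bs = n"
    and A: "A \<in> carrier_mat n n" and B: "B \<in> carrier_mat n n"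
    and eq: "\<And>b. b \<in> set bs \<Longrightarrow> A *\<^sub>v b = B *\<^sub>v b"
  shows "A = B"
proof -
  let ?P = "mat_of_cols n bs" and ?Q = "mat_of_rows n (map conjugate bs)"
  note PQ = orthonormal_list_unitary[OF bs len]
  have c: "bs ! i \<in> carrier_vec n" if "i < n" for i
    using bs that len unfolding orthonormal_list_def by force
  have "A * ?P = B * ?P"
  proof (rule mat_col_eqI)
    fix j assume "j < dim_col (B * ?P)"
    then show "col (A * ?P) j = col (B * ?P) j"
      using eq[of "bs ! j"] len c by (simp add: col_mult2[OF A PQ(1)] col_mult2[OF B PQ(1)])
  qed (use A B in auto)
  then have "A * ?P * ?Q = B * ?P * ?Q" by simp
  then show ?thesis
    using assoc_mult_mat[OF A PQ(1,2)] assoc_mult_mat[OF B PQ(1,2)] PQ(4) A B by simp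
qed

lemma orthonormal_basis_iff:
  "orthonormal_basis n bs \<longleftrightarrow> orthonormal_list n bs \<and> length bs = n"
proof -
  interpret vec_space "TYPE(complex)" n .
  show ?thesis
  proof
    assume h: "orthonormal_basis n bs"
    then have b: "basis (set bs)" unfolding orthonormal_basis_def by simp
    then have on: "orthonormal_list n bs"
      using h unfolding orthonormal_basis_def orthonormal_list_def basis_def by simp
    \<comment> \<open>A basis is a set, so distinctness is what turns the dimension into the length
      of the list.\<close>
    have "length bs = card (set bs)" using orthonormal_list_distinct[OF on] by (simp add: distinct_card)
    also have "\<dots> = n" using dim_basis[OF _ b] dim_is_n by simp
    finally show "orthonormal_list n bs \<and> length bs = n" using on by simp
  next
    assume h: "orthonormal_list n bs \<and> length bs = n"
    then have on: "orthonormal_list n bs" and len: "length bs = n" by auto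
    have car: "set bs \<subseteq> carrier_vec n" using on unfolding orthonormal_list_def by simp
    note PQ = orthonormal_list_unitary[OF on len]
    have "det (mat_of_cols n bs) \<noteq> 0" using det_mult[OF PQ(1,2)] PQ(4) by auto
    then have li: "lin_indpt (set bs)"
      using lin_dep_cols_imp_det_0[OF PQ(1)] car by auto
    have "basis (set bs)"
      using car li orthonormal_list_distinct[OF on] len
      by (intro dim_li_is_basis) (auto simp: distinct_card dim_is_n)
    then show "orthonormal_basis n bs"
      using on unfolding orthonormal_basis_def orthonormal_list_def by simp
  qed
qed

lemma orthonormal_eigenbasis_iff:
  assumes "A \<in> carrier_mat n n"
  shows "orthonormal_eigenbasis A bs \<longleftrightarrow>
    orthonormal_list n bs \<and> length bs = n \<and> (\<forall>b\<in>set bs. \<exists>k. eigenvector A b k)"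
  using assms unfolding orthonormal_eigenbasis_def orthonormal_basis_iff by auto

section \<open>Eigenvectors of self-adjoint matrices\<close>

lemma self_adjoint_cscalar_prod:
  assumes A: "A \<in> carrier_mat n n" and sa: "self_adjoint A"
    and u: "u \<in> carrier_vec n" and v: "v \<in> carrier_vec n"
  shows "(A *\<^sub>v u) \<bullet>c v = u \<bullet>c (A *\<^sub>v v)"
proof -
  have ent: "cnj (A $$ (i, j)) = A $$ (j, i)" if "i < n" "j < n" for i j
  proof -
    have "A $$ (j, i) = mat_adjoint A $$ (j, i)" using sa unfolding self_adjoint_def by simp
    also have "\<dots> = cnj (A $$ (i, j))"
      using A that unfolding mat_adjoint_def by (simp add: mat_of_rows_index)
    finally show ?thesis by (rule sym)
  qed
  have "(A *\<^sub>v u) \<bullet>c v = (\<Sum>i<n. \<Sum>j<n. A $$ (i, j) * u $ j * cnj (v $ i))"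
    using A u v by (simp add: scalar_prod_def atLeast0LessThan sum_distrib_right)
  also have "\<dots> = (\<Sum>j<n. \<Sum>i<n. A $$ (i, j) * u $ j * cnj (v $ i))"
    by (rule sum.swap)
  also have "\<dots> = (\<Sum>j<n. \<Sum>i<n. u $ j * cnj (A $$ (j, i) * v $ i))"
    by (intro sum.cong refl) (simp add: ent)
  also have "\<dots> = u \<bullet>c (A *\<^sub>v v)"
    using A u v by (simp add: scalar_prod_def atLeast0LessThan sum_distrib_left)
  finally show ?thesis .
qed

lemma self_adjoint_eigenvectors_orthogonal:
  assumes A: "A \<in> carrier_mat n n" and sa: "self_adjoint A"
    and u: "eigenvector A u k" and v: "eigenvector A v l" and ne: "k \<noteq> l"
  shows "u \<bullet>c v = 0"
proof -
  have uv: "u \<in> carrier_vec n" "A *\<^sub>v u = k \<cdot>\<^sub>v u"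
    "v \<in> carrier_vec n" "v \<noteq> 0\<^sub>v n" "A *\<^sub>v v = l \<cdot>\<^sub>v v"
    using u v A unfolding eigenvector_def by auto
  \<comment> \<open>Moving \<open>A\<close> across the product of \<open>v\<close> with itself shows
    that \<open>l\<close> is real; the same move for \<open>u\<close> and \<open>v\<close> then
    gives orthogonality.\<close>
  have "l * (v \<bullet>c v) = cnj l * (v \<bullet>c v)"
    using self_adjoint_cscalar_prod[OF A sa uv(3,3)] uv by (simp add: conjugate_smult_vec)
  then have "cnj l = l" using uv by simp
  moreover have "k * (u \<bullet>c v) = cnj l * (u \<bullet>c v)"
    using self_adjoint_cscalar_prod[OF A sa uv(1,3)] uv by (simp add: conjugate_smult_vec)
  ultimately show ?thesis using ne by simp
qed

lemma unit_multiple_exists: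
  fixes u :: "complex vec"
  assumes u: "u \<in> carrier_vec n" and u0: "u \<noteq> 0\<^sub>v n"
  shows "\<exists>c. c \<noteq> 0 \<and> (c \<cdot>\<^sub>v u) \<bullet>c (c \<cdot>\<^sub>v u) = 1"
proof -
  define r where "r = Re (u \<bullet>c u)"
  have "0 < u \<bullet>c u" using conjugate_square_greater_0_vec[OF u] u0 by simp
  \<comment> \<open>The order on complex numbers compares only numbers with equal imaginary parts,
    so positivity includes being real.\<close>
  then have r: "0 < r" "u \<bullet>c u = complex_of_real r"
    unfolding r_def by (auto simp: less_complex_def complex_eq_iff)
  let ?c = "complex_of_real (1 / sqrt r)"
  have "(?c \<cdot>\<^sub>v u) \<bullet>c (?c \<cdot>\<^sub>v u) = ?c * ?c * (u \<bullet>c u)"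
    using u by (simp add: conjugate_smult_vec)
  also have "\<dots> = complex_of_real (1 / sqrt r * (1 / sqrt r) * r)"
    unfolding r(2) by (simp only: of_real_mult)
  also have "1 / sqrt r * (1 / sqrt r) * r = 1" using r(1) by (simp add: field_simps)
  finally show ?thesis using r(1) by (intro exI[of _ ?c]) simp
qed

text \<open>One unit eigenvector per eigenvalue gives \<open>n\<close> pairwise orthogonal vectors,
  hence a basis.\<close>

lemma self_adjoint_simple_spectrum:
  assumes A: "A \<in> carrier_mat n n" and sa: "self_adjoint A" and simple: "simple_spectrum A"
  shows "\<exists>bs. orthonormal_eigenbasis A bs" and "nonderogatory A"
proof -
  have "\<exists>u. eigenvector A u k \<and> u \<bullet>c u = 1" if k: "k \<in> spectrum A" for k
  proof -
    obtain u where "eigenvector A u k" using k unfolding spectrum_def eigenvalue_def by auto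
    then have u: "u \<in> carrier_vec n" "u \<noteq> 0\<^sub>v n" "A *\<^sub>v u = k \<cdot>\<^sub>v u"
      using A unfolding eigenvector_def by auto
    obtain c where c: "c \<noteq> 0" "(c \<cdot>\<^sub>v u) \<bullet>c (c \<cdot>\<^sub>v u) = 1"
      using unit_multiple_exists[OF u(1,2)] by auto
    have "A *\<^sub>v (c \<cdot>\<^sub>v u) = k \<cdot>\<^sub>v (c \<cdot>\<^sub>v u)"
      using mult_mat_vec[OF A u(1)] u(3) by (simp add: smult_smult_assoc mult.commute)
    moreover have "c \<cdot>\<^sub>v u \<noteq> 0\<^sub>v n"
    proof
      assume "c \<cdot>\<^sub>v u = 0\<^sub>v n"
      then show False using c(2) unfolding \<open>c \<cdot>\<^sub>v u = 0\<^sub>v n\<close> by simp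
    qed
    ultimately have "eigenvector A (c \<cdot>\<^sub>v u) k" using A u(1) unfolding eigenvector_def by auto
    then show ?thesis using c(2) by blast
  qed
  then obtain f where f: "\<And>k. k \<in> spectrum A \<Longrightarrow> eigenvector A (f k) k \<and> f k \<bullet>c f k = 1"
    by metis
  obtain ks where ks: "set ks = spectrum A" "distinct ks"
    using finite_distinct_list[OF card_finite_spectrum(1)[OF A]] by auto
  define bs where "bs = map f ks"
  have len: "length bs = n" "length ks = n"
    using simple ks distinct_card[of ks] unfolding simple_spectrum_iff_card[OF A] bs_def by auto
  have car: "f k \<in> carrier_vec n" if "k \<in> spectrum A" for k
    using f[OF that] A unfolding eigenvector_def by auto
  have orth: "f k \<bullet>c f l = 0" if "k \<in> spectrum A" "l \<in> spectrum A" "k \<noteq> l" for k l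
    using self_adjoint_eigenvectors_orthogonal[OF A sa] f that by blast
  have on: "orthonormal_list n bs"
    unfolding orthonormal_list_def
  proof (intro conjI allI impI)
    show "set bs \<subseteq> carrier_vec n" unfolding bs_def using car ks by auto
    fix i j assume ij: "i < length bs" "j < length bs"
    then have "ks ! i \<in> spectrum A" "ks ! j \<in> spectrum A" "ks ! i = ks ! j \<longleftrightarrow> i = j"
      using ks len nth_mem[of _ ks] by (auto simp: nth_eq_iff_index_eq)
    then show "bs ! i \<bullet>c bs ! j = (if i = j then 1 else 0)"
      using f orth ij unfolding bs_def by auto
  qed
  have ev: "\<exists>k. eigenvector A b k" if "b \<in> set bs" for b
    using that f ks unfolding bs_def by auto
  then have "orthonormal_eigenbasis A bs"
    using on len orthonormal_eigenbasis_iff[OF A] by auto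
  then show "\<exists>bs. orthonormal_eigenbasis A bs" by blast
  \<comment> \<open>\<open>v\<close> is orthogonal to every \<open>f l\<close> with \<open>l\<close>
    different from \<open>k\<close>, so removing its component along \<open>f k\<close> leaves a
    vector orthogonal to the whole basis.\<close>
  have mult: "v = (v \<bullet>c f k) \<cdot>\<^sub>v f k" if v: "eigenvector A v k" for v k
  proof -
    have k: "k \<in> spectrum A" using v unfolding spectrum_def eigenvalue_def by auto
    have vc: "v \<in> carrier_vec n" using v A unfolding eigenvector_def by auto
    have "v - (v \<bullet>c f k) \<cdot>\<^sub>v f k = 0\<^sub>v n"
    proof (rule orthonormal_list_complete[OF on len(1)])
      fix b assume "b \<in> set bs"
      then obtain l where l: "b = f l" "l \<in> spectrum A" unfolding bs_def using ks by auto
      have bc: "conjugate b \<in> carrier_vec n" using l car by auto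
      have "(v - (v \<bullet>c f k) \<cdot>\<^sub>v f k) \<bullet>c b = v \<bullet>c b - (v \<bullet>c f k) * (f k \<bullet>c b)"
        using minus_scalar_prod_distrib[OF vc _ bc, of "(v \<bullet>c f k) \<cdot>\<^sub>v f k"]
          smult_scalar_prod_distrib[OF car[OF k] bc] car[OF k] by simp
      also have "\<dots> = 0"
        using f orth[OF k l(2)] k l self_adjoint_eigenvectors_orthogonal[OF A sa v, of b l]
        by (cases "k = l") auto
      finally show "(v - (v \<bullet>c f k) \<cdot>\<^sub>v f k) \<bullet>c b = 0" .
    qed (use vc car[OF k] in auto)
    then have "(v - (v \<bullet>c f k) \<cdot>\<^sub>v f k) $ i = 0" if "i < n" for i using that by simp
    then show ?thesis using vc car[OF k] by (intro eq_vecI) auto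
  qed
  show "nonderogatory A"
    unfolding nonderogatory_def
  proof (intro allI impI)
    fix u v k assume u: "eigenvector A u k" and v: "eigenvector A v k"
    define c where "c = u \<bullet>c f k"
    have fk: "f k \<in> carrier_vec n"
      using car u unfolding spectrum_def eigenvalue_def by auto
    have u_eq: "u = c \<cdot>\<^sub>v f k" using mult[OF u] unfolding c_def .
    have "c \<noteq> 0"
    proof
      assume "c = 0"
      then have "u = 0\<^sub>v n" unfolding u_eq using fk by (intro eq_vecI) auto
      then show False using u A unfolding eigenvector_def by auto
    qed
    \<comment> \<open>Both \<open>u\<close> and \<open>v\<close> are multiples of
      \<open>f k\<close>; inverting the first relation expresses \<open>v\<close> through
      \<open>u\<close>.\<close>
    then have "f k = (1 / c) \<cdot>\<^sub>v u" unfolding u_eq using fk by (intro eq_vecI) auto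
    then have "v = (v \<bullet>c f k) \<cdot>\<^sub>v ((1 / c) \<cdot>\<^sub>v u)" using mult[OF v] by simp
    then show "\<exists>c. v = c \<cdot>\<^sub>v u" unfolding smult_smult_assoc by blast
  qed
qed

text \<open>Two members of the basis with the same eigenvalue would be parallel, contrary to
  orthogonality, so \<open>n\<close> distinct eigenvalues occur.\<close>

lemma nonderogatory_simple_spectrum:
  assumes A: "A \<in> carrier_mat n n" and nd: "nonderogatory A"
    and bs: "orthonormal_eigenbasis A bs"
  shows "simple_spectrum A"
proof -
  have on: "orthonormal_list n bs" "length bs = n" "\<forall>b\<in>set bs. \<exists>k. eigenvector A b k"
    using bs unfolding orthonormal_eigenbasis_iff[OF A] by auto
  have "\<forall>i\<in>{..<n}. \<exists>k. eigenvector A (bs ! i) k" using on by auto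
  then obtain g where g: "\<And>i. i < n \<Longrightarrow> eigenvector A (bs ! i) (g i)" by (metis lessThan_iff)
  have "inj_on g {..<n}"
  proof (rule inj_onI)
    fix i j assume "i \<in> {..<n}" "j \<in> {..<n}" "g i = g j"
    then have ij: "i < n" "j < n" "eigenvector A (bs ! i) (g i)" "eigenvector A (bs ! j) (g i)"
      using g[of i] g[of j] by auto
    obtain c where c: "bs ! j = c \<cdot>\<^sub>v bs ! i" by (rule nonderogatoryD[OF nd ij(3,4)])
    have car: "bs ! i \<in> carrier_vec n" using ij(3) A unfolding eigenvector_def by auto
    have "bs ! j \<bullet>c bs ! j = c * (bs ! i \<bullet>c bs ! j)"
      using car arg_cong[OF c, of "\<lambda>w. w \<bullet>c bs ! j"] ij(4) A
      by (simp add: eigenvector_def)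
    then show "i = j" using on ij(1,2) unfolding orthonormal_list_def by (auto split: if_splits)
  qed
  moreover have "g ` {..<n} \<subseteq> spectrum A"
    using g unfolding spectrum_def eigenvalue_def by auto
  ultimately have "n \<le> card (spectrum A)"
    using card_inj_on_le[OF _ _ card_finite_spectrum(1)[OF A]] by fastforce
  then show ?thesis
    unfolding simple_spectrum_iff_card[OF A] using card_finite_spectrum(2)[OF A] by simp
qed

text \<open>Each \<open>cs ! i\<close> has a nonzero product with some \<open>bs ! j\<close>. Both
  then have the same eigenvalue, so they are parallel, and unit norms make the factor a
  phase.\<close>

lemma self_adjoint_eigenbasis_unique:
  assumes A: "A \<in> carrier_mat n n" and sa: "self_adjoint A" and nd: "nonderogatory A"
    and bs: "orthonormal_eigenbasis A bs" and cs: "orthonormal_eigenbasis A cs"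
  shows "same_up_to_order_and_phase bs cs"
proof -
  have b: "orthonormal_list n bs" "length bs = n" "\<forall>b\<in>set bs. \<exists>k. eigenvector A b k"
    using bs unfolding orthonormal_eigenbasis_iff[OF A] by auto
  have c: "orthonormal_list n cs" "length cs = n" "\<forall>b\<in>set cs. \<exists>k. eigenvector A b k"
    using cs unfolding orthonormal_eigenbasis_iff[OF A] by auto
  have bc: "bs ! i \<in> carrier_vec n" "cs ! i \<in> carrier_vec n"
    "bs ! i \<bullet>c bs ! i = 1" "cs ! i \<bullet>c cs ! i = 1" if "i < n" for i
    using b(1,2) c(1,2) that unfolding orthonormal_list_def by force+
  have "\<exists>j z. j < n \<and> cmod z = 1 \<and> cs ! i = z \<cdot>\<^sub>v bs ! j" if i: "i < n" for i
  proof -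
    obtain k where k: "eigenvector A (cs ! i) k" using c(2,3) i nth_mem by blast
    have "cs ! i \<noteq> 0\<^sub>v n" using k A unfolding eigenvector_def by auto
    then obtain j where j: "j < n" "cs ! i \<bullet>c bs ! j \<noteq> 0"
      using orthonormal_list_complete[OF b(1,2) bc(2)[OF i]] b(2) by (metis in_set_conv_nth)
    obtain l where l: "eigenvector A (bs ! j) l" using b(2,3) j(1) nth_mem by blast
    then have "l = k" using self_adjoint_eigenvectors_orthogonal[OF A sa k l] j by auto
    then obtain z where z: "cs ! i = z \<cdot>\<^sub>v bs ! j"
      using nonderogatoryD[OF nd l] k by blast
    have "cs ! i \<bullet>c cs ! i = z * cnj z * (bs ! j \<bullet>c bs ! j)"
      using bc[OF j(1)] unfolding z by (simp add: conjugate_smult_vec)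
    then have "z * cnj z = 1" using bc(3)[OF j(1)] bc(4)[OF i] by simp
    then have "cmod z = 1"
      by (metis complex_mod_sqrt_Re_mult_cnj one_complex.sel(1) real_sqrt_one)
    then show ?thesis using j z by blast
  qed
  then obtain q z where qz: "\<And>i. i < n \<Longrightarrow> q i < n \<and> cmod (z i) = 1 \<and> cs ! i = z i \<cdot>\<^sub>v bs ! q i"
    by metis
  \<comment> \<open>A permutation of \<open>{..<n}\<close> has to fix everything outside, hence the
    default \<open>i\<close>.\<close>
  define p where "p i = (if i < n then q i else i)" for i
  \<comment> \<open>Two vectors of \<open>cs\<close> parallel to the same \<open>bs ! q i\<close>
    are not orthogonal, so they have the same index.\<close>
  have "inj_on p {..<n}"
  proof (rule inj_onI)
    fix i j assume "i \<in> {..<n}" "j \<in> {..<n}" "p i = p j"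
    then have ij: "i < n" "j < n" "q i = q j" unfolding p_def by auto
    have ne: "z i \<noteq> 0" "z j \<noteq> 0" using qz ij by force+
    have "cs ! i \<bullet>c cs ! j = z i * cnj (z j) * (bs ! q i \<bullet>c bs ! q i)"
      using qz[OF ij(1)] qz[OF ij(2)] bc(1)[of "q i"] ij(3) by (simp add: conjugate_smult_vec)
    then have "cs ! i \<bullet>c cs ! j \<noteq> 0" using bc(3)[of "q i"] qz[OF ij(1)] ne by simp
    then show "i = j" using c ij unfolding orthonormal_list_def by (auto split: if_splits)
  qed
  moreover have "p ` {..<n} \<subseteq> {..<n}" using qz unfolding p_def by auto
  ultimately have "bij_betw p {..<n} {..<n}"
    unfolding bij_betw_def by (simp add: endo_inj_surj)
  then have "p permutes {..<n}" by (rule bij_imp_permutes) (simp add: p_def)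
  then show ?thesis
    unfolding same_up_to_order_and_phase_def b(2) c(2) using qz
    by (intro conjI exI[of _ p] exI[of _ z]) (auto simp: p_def)
qed

section \<open>Commutation and common eigenbases\<close>

lemma commuting_orthonormal_eigenbasis:
  assumes A: "A \<in> carrier_mat n n" and B: "B \<in> carrier_mat n n" and comm: "A * B = B * A"
    and "nonderogatory A" "nonderogatory B"
  shows "orthonormal_eigenbasis A bs \<longleftrightarrow> orthonormal_eigenbasis B bs"
  unfolding orthonormal_eigenbasis_iff[OF A] orthonormal_eigenbasis_iff[OF B]
  using commuting_eigenvector[OF A B comm] commuting_eigenvector[OF B A comm[symmetric]] assms(4,5)
  by blast

text \<open>Both products scale each basis vector by the same number. For \<open>B\<close> only
  eigenvectors are asked for, since in the application it may be a multiple of the identity.\<close>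

lemma common_eigenbasis_commute:
  assumes A: "A \<in> carrier_mat n n" and B: "B \<in> carrier_mat n n"
    and bsA: "orthonormal_eigenbasis A bs" and bsB: "\<And>b. b \<in> set bs \<Longrightarrow> \<exists>k. eigenvector B b k"
  shows "A * B = B * A"
proof -
  have on: "orthonormal_list n bs" "length bs = n" "\<forall>b\<in>set bs. \<exists>k. eigenvector A b k"
    using bsA unfolding orthonormal_eigenbasis_iff[OF A] by auto
  show ?thesis
  proof (rule orthonormal_list_eq_matI[OF on(1,2)])
    fix b assume b: "b \<in> set bs"
    obtain k l where "eigenvector A b k" "eigenvector B b l" using on(3) bsB b by blast
    then have kl: "b \<in> carrier_vec n" "A *\<^sub>v b = k \<cdot>\<^sub>v b" "B *\<^sub>v b = l \<cdot>\<^sub>v b"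
      using A unfolding eigenvector_def by auto
    have "A * B *\<^sub>v b = l \<cdot>\<^sub>v (k \<cdot>\<^sub>v b)"
      using assoc_mult_mat_vec[OF A B kl(1)] mult_mat_vec[OF A kl(1)] kl by simp
    also have "\<dots> = k \<cdot>\<^sub>v (l \<cdot>\<^sub>v b)" by (simp add: smult_smult_assoc mult.commute)
    also have "\<dots> = B * A *\<^sub>v b"
      using assoc_mult_mat_vec[OF B A kl(1)] mult_mat_vec[OF B kl(1)] kl by simp
    finally show "A * B *\<^sub>v b = B * A *\<^sub>v b" .
  qed (use A B in auto)
qed

lemma commutator_eq_zero_iff:
  assumes "A \<in> carrier_mat n n" "B \<in> carrier_mat n n"
  shows "commutator A B = 0\<^sub>m n n \<longleftrightarrow> A * B = B * A"
proof
  assume zero: "commutator A B = 0\<^sub>m n n"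
  show "A * B = B * A"
  proof (rule eq_matI)
    fix i j assume ij: "i < dim_row (B * A)" "j < dim_col (B * A)"
    have "commutator A B $$ (i, j) = 0" unfolding zero using ij assms by simp
    then show "(A * B) $$ (i, j) = (B * A) $$ (i, j)"
      using ij unfolding commutator_def by simp
  qed (use assms in auto)
next
  assume "A * B = B * A"
  then show "commutator A B = 0\<^sub>m n n" unfolding commutator_def using assms by (intro eq_matI) auto
qed

section \<open>Symmetric tridiagonal matrices\<close>

lemma sym_tridiagonalD:
  assumes "A \<in> sym_tridiagonal n"
  shows "A \<in> carrier_mat n n"
    and "i < n \<Longrightarrow> j < n \<Longrightarrow> A $$ (i, j) = A $$ (j, i)"
    and "i < n \<Longrightarrow> j < n \<Longrightarrow> i + 1 < j \<Longrightarrow> A $$ (i, j) = 0"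
    and "i < n \<Longrightarrow> j < n \<Longrightarrow> j + 1 < i \<Longrightarrow> A $$ (i, j) = 0"
proof -
  have A: "A \<in> carrier_mat n n" "transpose_mat A = A"
    "\<forall>i<n. \<forall>j<n. i + 1 < j \<or> j + 1 < i \<longrightarrow> A $$ (i, j) = 0"
    using assms unfolding sym_tridiagonal_def by auto
  show "A \<in> carrier_mat n n" using A(1) .
  show "A $$ (i, j) = A $$ (j, i)" if "i < n" "j < n"
    using index_transpose_mat(1)[of i A j] A(1,2) that by simp
  show "i < n \<Longrightarrow> j < n \<Longrightarrow> i + 1 < j \<Longrightarrow> A $$ (i, j) = 0"
    "i < n \<Longrightarrow> j < n \<Longrightarrow> j + 1 < i \<Longrightarrow> A $$ (i, j) = 0"
    using A(3) by auto
qed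

lemma irreducible_sym_tridiagonalD:
  assumes "T \<in> irreducible_sym_tridiagonal n"
  shows "T \<in> sym_tridiagonal n" and "i + 1 < n \<Longrightarrow> T $$ (i, i + 1) \<noteq> 0"
  using assms unfolding irreducible_sym_tridiagonal_def by auto

lemma irreducible_sym_tridiagonal_nonderogatory:
  assumes "T \<in> irreducible_sym_tridiagonal n"
  shows "nonderogatory (cmat T)"
proof (rule unreduced_hessenberg_nonderogatory)
  note T = irreducible_sym_tridiagonalD[OF assms]
  note T' = sym_tridiagonalD[OF T(1)]
  show "cmat T \<in> carrier_mat n n" using T'(1) by simp
  show "cmat T $$ (i, j) = 0" if "j < n" "i + 1 < j" for i j
    using T'(1) T'(3)[of i j] that by simp
  show "cmat T $$ (i, i + 1) \<noteq> 0" if "i + 1 < n" for i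
    using T'(1) T(2) that by simp
qed

text \<open>The general entry type serves two uses: the complex \<open>R\<close> with
  \<open>cmat T\<close>, and the real \<open>T\<close> with itself.\<close>

lemma commute_affine:
  fixes S T :: "'a :: comm_ring_1 mat"
  assumes S: "S \<in> carrier_mat n n" and T: "T \<in> carrier_mat n n" and comm: "S * T = T * S"
  shows "S * (\<alpha> \<cdot>\<^sub>m T + \<beta> \<cdot>\<^sub>m 1\<^sub>m n) = (\<alpha> \<cdot>\<^sub>m T + \<beta> \<cdot>\<^sub>m 1\<^sub>m n) * S"
proof -
  have C: "\<alpha> \<cdot>\<^sub>m T \<in> carrier_mat n n" "\<beta> \<cdot>\<^sub>m 1\<^sub>m n \<in> carrier_mat n n"
    using T by auto
  have "S * (\<alpha> \<cdot>\<^sub>m T + \<beta> \<cdot>\<^sub>m 1\<^sub>m n) = \<alpha> \<cdot>\<^sub>m (S * T) + \<beta> \<cdot>\<^sub>m S"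
    by (simp only: mult_add_distrib_mat[OF S C] mult_smult_distrib[OF S T]
        mult_smult_distrib[OF S one_carrier_mat] right_mult_one_mat[OF S])
  also have "\<dots> = (\<alpha> \<cdot>\<^sub>m T + \<beta> \<cdot>\<^sub>m 1\<^sub>m n) * S"
    by (simp only: comm add_mult_distrib_mat[OF C S] mult_smult_assoc_mat[OF T S]
        mult_smult_assoc_mat[OF one_carrier_mat S] left_mult_one_mat[OF S])
  finally show ?thesis .
qed

lemma sym_tridiagonal_affine:
  assumes "T \<in> sym_tridiagonal n"
  shows "\<alpha> \<cdot>\<^sub>m T + \<beta> \<cdot>\<^sub>m 1\<^sub>m n \<in> sym_tridiagonal n"
  using sym_tridiagonalD[OF assms] unfolding sym_tridiagonal_def by (auto intro!: eq_matI)

lemma irreducible_sym_tridiagonal_affine: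
  assumes T: "T \<in> irreducible_sym_tridiagonal n" and "\<alpha> \<noteq> 0"
  shows "\<alpha> \<cdot>\<^sub>m T + \<beta> \<cdot>\<^sub>m 1\<^sub>m n \<in> irreducible_sym_tridiagonal n"
  using sym_tridiagonal_affine[OF irreducible_sym_tridiagonalD(1)[OF T]]
    irreducible_sym_tridiagonalD(2)[OF T] sym_tridiagonalD(1)[OF irreducible_sym_tridiagonalD(1)[OF T]]
    assms(2)
  unfolding irreducible_sym_tridiagonal_def by auto

text \<open>The first row of a tridiagonal matrix has at most two nonzero entries, so two
  coefficients suffice to match it, and the first row determines a matrix commuting with
  \<open>T\<close>.\<close>

lemma irreducible_sym_tridiagonal_commuting:
  assumes T: "T \<in> irreducible_sym_tridiagonal n" and A: "A \<in> sym_tridiagonal n"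
    and comm: "T * A = A * T"
  shows "\<exists>\<alpha> \<beta>. A = \<alpha> \<cdot>\<^sub>m T + \<beta> \<cdot>\<^sub>m 1\<^sub>m n"
proof -
  note T' = irreducible_sym_tridiagonalD[OF T]
  note Td = sym_tridiagonalD[OF T'(1)]
  note Ad = sym_tridiagonalD[OF A]
  \<comment> \<open>\<alpha> matches the entry (0, 1), with default 0 when there is no such entry;
    \<beta> then corrects the corner.\<close>
  define \<alpha> where "\<alpha> = (if 1 < n then A $$ (0, 1) / T $$ (0, 1) else 0)"
  define \<beta> where "\<beta> = A $$ (0, 0) - \<alpha> * T $$ (0, 0)"
  let ?C = "\<alpha> \<cdot>\<^sub>m T + \<beta> \<cdot>\<^sub>m 1\<^sub>m n"
  have C: "?C \<in> carrier_mat n n" using Td(1) by simp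
  have "A - ?C = 0\<^sub>m n n"
  proof (rule unreduced_hessenberg_commuting_zero[OF Td(1)])
    show "T $$ (i, j) = 0" if "j < n" "i + 1 < j" for i j using Td(3)[of i j] that by simp
    show "T $$ (i, i + 1) \<noteq> 0" if "i + 1 < n" for i using T'(2) that .
    show "A - ?C \<in> carrier_mat n n" using C by (rule minus_carrier_mat)
    show "T * (A - ?C) = (A - ?C) * T"
      using comm commute_affine[OF Td(1) Td(1) refl]
      by (simp add: mult_minus_distrib_mat[OF Td(1) Ad(1) C] minus_mult_distrib_mat[OF Ad(1) C Td(1)])
    show "(A - ?C) $$ (0, j) = 0" if j: "j < n" for j
    proof -
      consider "j = 0" | "j = 1" | "1 < j" by linarith
      then show ?thesis
      proof cases
        case 1
        then show ?thesis using j Td(1) Ad(1) unfolding \<beta>_def by simp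
      next
        case 2
        then show ?thesis using j Td(1) Ad(1) T'(2)[of 0] unfolding \<alpha>_def by simp
      next
        case 3
        then show ?thesis using j Td(1) Ad(1) Td(3)[of 0 j] Ad(3)[of 0 j] by simp
      qed
    qed
  qed
  then have zero: "(A - ?C) $$ (i, j) = 0" if "i < n" "j < n" for i j using that by simp
  have "A = ?C"
  proof (rule eq_matI)
    fix i j assume ij: "i < dim_row ?C" "j < dim_col ?C"
    then have "A $$ (i, j) - ?C $$ (i, j) = 0"
      using zero[of i j] C by auto
    then show "A $$ (i, j) = ?C $$ (i, j)" by simp
  qed (use Ad(1) in auto)
  then show ?thesis by blast
qed

section \<open>Spans and dependence of pairs of matrices\<close>

context matrix_vs
begin

lemma lincomb_pair:
  assumes "x \<in> carrier_mat nr nc" "y \<in> carrier_mat nr nc" "x \<noteq> y"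
  shows "lincomb a {x, y} = a x \<cdot>\<^sub>m x + a y \<cdot>\<^sub>m y"
proof -
  have y: "lincomb a {y} = a y \<cdot>\<^sub>m y"
    using lincomb_insert[of "{}" a y] assms by (simp add: lincomb_def)
  show ?thesis
    using lincomb_insert[of "{y}" a x] assms y by (simp add: insert_commute)
qed

lemma span_pair:
  assumes x: "x \<in> carrier_mat nr nc" and y: "y \<in> carrier_mat nr nc"
  shows "span {x, y} = {a \<cdot>\<^sub>m x + b \<cdot>\<^sub>m y | a b. True}"
\<comment> \<open>For equal matrices the set is a singleton. This can occur in the theorem: for
  \<open>M = 1\<close>, \<open>T\<close> may be the identity.\<close>
proof (cases "x = y")
  case True
  have l: "lincomb a {y} = a y \<cdot>\<^sub>m y" for a
    using lincomb_insert[of "{}" a y] assms by (simp add: lincomb_def)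
  have s: "span {y} = {a \<cdot>\<^sub>m y | a. True}"
    using finite_span[of "{y}"] y l by (auto intro: exI[of _ "\<lambda>_. _"])
  have "\<exists>c. a \<cdot>\<^sub>m y + b \<cdot>\<^sub>m y = c \<cdot>\<^sub>m y" for a b
    using add_smult_distrib_right_mat[OF y] by metis
  moreover have "\<exists>b c. a \<cdot>\<^sub>m y = b \<cdot>\<^sub>m y + c \<cdot>\<^sub>m y" for a
    using add_smult_distrib_right_mat[OF y, of a 0] by (metis add.right_neutral)
  ultimately show ?thesis unfolding True using s by auto
next
  case False
  have "span {x, y} = {a x \<cdot>\<^sub>m x + a y \<cdot>\<^sub>m y | a. True}"
    using finite_span[of "{x, y}"] x y lincomb_pair[OF x y False] by auto
  also have "\<dots> = {a \<cdot>\<^sub>m x + b \<cdot>\<^sub>m y | a b. True}"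
  proof (intro equalityI subsetI)
    fix m assume "m \<in> {a \<cdot>\<^sub>m x + b \<cdot>\<^sub>m y | a b. True}"
    then obtain a b where "m = a \<cdot>\<^sub>m x + b \<cdot>\<^sub>m y" by auto
    then show "m \<in> {a x \<cdot>\<^sub>m x + a y \<cdot>\<^sub>m y | a. True}"
      using False by (auto intro!: exI[of _ "(\<lambda>_. a)(y := b)"])
  qed auto
  finally show ?thesis .
qed

lemma scalar_multiple_lin_dep:
  assumes "x \<in> carrier_mat nr nc" "x \<noteq> c \<cdot>\<^sub>m x"
  shows "lin_dep {x, c \<cdot>\<^sub>m x}"
proof -
  \<comment> \<open>The relation is \<open>-c\<close> times \<open>x\<close> plus 1 times
    \<open>c \<cdot>\<^sub>m x\<close>; the coefficient 1 makes it nontrivial even for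
    \<open>c = 0\<close>.\<close>
  let ?a = "\<lambda>v. if v = x then - c else 1"
  have "lincomb ?a {x, c \<cdot>\<^sub>m x} = 0\<^sub>m nr nc"
    using lincomb_pair[of x "c \<cdot>\<^sub>m x" ?a] assms by (auto intro!: eq_matI)
  then show ?thesis
    unfolding lin_dep_def using assms
    by (intro exI[of _ "{x, c \<cdot>\<^sub>m x}"] exI[of _ ?a] exI[of _ "c \<cdot>\<^sub>m x"]) auto
qed

end

lemma independent_pair_not_multiple:
  assumes "independent_pair n A B" "A \<in> carrier_mat n n"
  shows "B \<noteq> c \<cdot>\<^sub>m A"
  using assms matrix_vs.scalar_multiple_lin_dep[of A n n c]
  unfolding independent_pair_def by auto

section \<open>The commutant of \<open>R\<close> and its eigenbases\<close>

theorem theorem12p2: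
  fixes M :: nat and R :: "complex mat" and T :: "real mat"
  assumes "R \<in> carrier_mat M M"
    and "self_adjoint R"
    and "simple_spectrum R"
    and "T \<in> irreducible_sym_tridiagonal M"
    and "commutator R (cmat T) = 0\<^sub>m M M"
  shows "{A \<in> sym_tridiagonal M. commutator R (cmat A) = 0\<^sub>m M M}
           = real_mat_span M {1\<^sub>m M, T} \<and>
    (\<forall>A \<in> {A \<in> sym_tridiagonal M. commutator R (cmat A) = 0\<^sub>m M M}.
        independent_pair M (1\<^sub>m M) A \<longrightarrow>
          (\<exists>\<alpha> \<beta> :: real. \<alpha> \<noteq> 0 \<and> A = \<alpha> \<cdot>\<^sub>m T + \<beta> \<cdot>\<^sub>m 1\<^sub>m M) \<and>
          simple_spectrum (cmat A) \<and>
          (\<exists>bs. orthonormal_eigenbasis (cmat A) bs) \<and>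
          (\<forall>bs. orthonormal_eigenbasis (cmat A) bs \<longleftrightarrow> orthonormal_eigenbasis (cmat T) bs) \<and>
          (\<forall>bs. orthonormal_eigenbasis (cmat A) bs \<longleftrightarrow> is_KLT R bs) \<and>
          (\<forall>bs cs. orthonormal_eigenbasis (cmat A) bs \<and> is_KLT R cs \<longrightarrow>
             same_up_to_order_and_phase bs cs))"
proof (intro conjI ballI impI)
  let ?comm = "{A \<in> sym_tridiagonal M. commutator R (cmat A) = 0\<^sub>m M M}"
  note R = assms(1)
  have Ttri: "T \<in> sym_tridiagonal M" using irreducible_sym_tridiagonalD(1)[OF assms(4)] .
  have T: "T \<in> carrier_mat M M" using sym_tridiagonalD(1)[OF Ttri] .
  have cT: "cmat T \<in> carrier_mat M M" using T by simp
  have RT: "R * cmat T = cmat T * R" using assms(5) commutator_eq_zero_iff[OF R cT] by simp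
  note Rspec = self_adjoint_simple_spectrum[OF R assms(2,3)]
  obtain ws where ws: "orthonormal_eigenbasis R ws" using Rspec(1) by blast
  have affine: "\<exists>\<alpha> \<beta>. A = \<alpha> \<cdot>\<^sub>m T + \<beta> \<cdot>\<^sub>m 1\<^sub>m M" if "A \<in> ?comm" for A
  proof -
    have Atri: "A \<in> sym_tridiagonal M" using that by simp
    have A: "A \<in> carrier_mat M M" using sym_tridiagonalD(1)[OF Atri] .
    have cA: "cmat A \<in> carrier_mat M M" using A by simp
    have RA: "R * cmat A = cmat A * R" using that commutator_eq_zero_iff[OF R cA] by simp
    have "orthonormal_eigenbasis (cmat T) ws"
      using ws commuting_orthonormal_eigenbasis[OF R cT RT Rspec(2)
          irreducible_sym_tridiagonal_nonderogatory[OF assms(4)]] by simp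
    moreover have "\<exists>k. eigenvector (cmat A) b k" if "b \<in> set ws" for b
      using commuting_eigenvector[OF R cA RA Rspec(2)] ws that
      unfolding orthonormal_eigenbasis_def by blast
    \<comment> \<open>The eigenbasis \<open>ws\<close> of \<open>R\<close> serves both
      \<open>T\<close> and \<open>A\<close>, which links the two matrices through
      \<open>R\<close>.\<close>
    ultimately have "cmat T * cmat A = cmat A * cmat T"
      by (rule common_eigenbasis_commute[OF cT cA])
    \<comment> \<open>Commutation descends to the real matrices because \<open>cmat\<close> is
      multiplicative and injective.\<close>
    then have "cmat (T * A) = cmat (A * T)"
      by (simp add: of_real_hom.mat_hom_mult[OF T A] of_real_hom.mat_hom_mult[OF A T])
    then have "T * A = A * T" by (rule of_real_hom.mat_hom_inj)
    then show ?thesis by (rule irreducible_sym_tridiagonal_commuting[OF assms(4) Atri])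
  qed
  have span: "real_mat_span M {1\<^sub>m M, T} = {a \<cdot>\<^sub>m 1\<^sub>m M + b \<cdot>\<^sub>m T | a b. True}"
    by (rule matrix_vs.span_pair[OF one_carrier_mat T])
  have swap: "a \<cdot>\<^sub>m 1\<^sub>m M + b \<cdot>\<^sub>m T = b \<cdot>\<^sub>m T + a \<cdot>\<^sub>m 1\<^sub>m M" for a b
    using T by (intro comm_add_mat) auto
  show "?comm = real_mat_span M {1\<^sub>m M, T}"
  proof (intro equalityI subsetI)
    fix A assume "A \<in> ?comm"
    then show "A \<in> real_mat_span M {1\<^sub>m M, T}" using affine[of A] unfolding span swap by blast
  next
    fix A assume "A \<in> real_mat_span M {1\<^sub>m M, T}"
    then obtain \<alpha> \<beta> where A: "A = \<alpha> \<cdot>\<^sub>m T + \<beta> \<cdot>\<^sub>m 1\<^sub>m M" unfolding span swap by blast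
    have "cmat A = complex_of_real \<alpha> \<cdot>\<^sub>m cmat T + complex_of_real \<beta> \<cdot>\<^sub>m 1\<^sub>m M"
      unfolding A using T by (intro eq_matI) auto
    then have "R * cmat A = cmat A * R" using commute_affine[OF R cT RT] by simp
    moreover have "A \<in> sym_tridiagonal M" unfolding A by (rule sym_tridiagonal_affine[OF Ttri])
    moreover have "cmat A \<in> carrier_mat M M" unfolding A using T by simp
    ultimately show "A \<in> ?comm" using commutator_eq_zero_iff[OF R] by simp
  qed
  fix A assume mem: "A \<in> ?comm" and ind: "independent_pair M (1\<^sub>m M) A"
  obtain \<alpha> \<beta> where A: "A = \<alpha> \<cdot>\<^sub>m T + \<beta> \<cdot>\<^sub>m 1\<^sub>m M" using affine[OF mem] by blast
  have \<alpha>: "\<alpha> \<noteq> 0"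
  proof
    assume "\<alpha> = 0"
    then have "A = \<beta> \<cdot>\<^sub>m 1\<^sub>m M" unfolding A using T by (intro eq_matI) auto
    then show False using independent_pair_not_multiple[OF ind] by simp
  qed
  have cA: "cmat A \<in> carrier_mat M M" unfolding A using T by simp
  have RA: "R * cmat A = cmat A * R" using mem commutator_eq_zero_iff[OF R cA] by simp
  \<comment> \<open>A nonzero \<alpha> keeps the off-diagonal entries nonzero, so the eigenspaces of
    \<open>A\<close> are lines too.\<close>
  have "A \<in> irreducible_sym_tridiagonal M"
    unfolding A by (rule irreducible_sym_tridiagonal_affine[OF assms(4) \<alpha>])
  then have ndA: "nonderogatory (cmat A)" by (rule irreducible_sym_tridiagonal_nonderogatory)
  have eqR: "orthonormal_eigenbasis (cmat A) bs \<longleftrightarrow> orthonormal_eigenbasis R bs" for bs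
    using commuting_orthonormal_eigenbasis[OF R cA RA Rspec(2) ndA] by simp
  have eqT: "orthonormal_eigenbasis (cmat T) bs \<longleftrightarrow> orthonormal_eigenbasis R bs" for bs
    using commuting_orthonormal_eigenbasis[OF R cT RT Rspec(2)
        irreducible_sym_tridiagonal_nonderogatory[OF assms(4)]] by simp
  show "\<exists>\<alpha> \<beta> :: real. \<alpha> \<noteq> 0 \<and> A = \<alpha> \<cdot>\<^sub>m T + \<beta> \<cdot>\<^sub>m 1\<^sub>m M" using A \<alpha> by blast
  show "\<exists>bs. orthonormal_eigenbasis (cmat A) bs" using ws eqR by blast
  then show "simple_spectrum (cmat A)" using nonderogatory_simple_spectrum[OF cA ndA] by blast
  show "\<forall>bs. orthonormal_eigenbasis (cmat A) bs \<longleftrightarrow> orthonormal_eigenbasis (cmat T) bs"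
    using eqR eqT by blast
  show "\<forall>bs. orthonormal_eigenbasis (cmat A) bs \<longleftrightarrow> orthonormal_eigenbasis R bs"
    using eqR by blast
  show "\<forall>bs cs. orthonormal_eigenbasis (cmat A) bs \<and> orthonormal_eigenbasis R cs \<longrightarrow>
      same_up_to_order_and_phase bs cs"
    \<comment> \<open>By \<open>eqR\<close> both lists are eigenbases of \<open>R\<close>, so
      uniqueness for \<open>R\<close> applies.\<close>
    using eqR self_adjoint_eigenbasis_unique[OF R assms(2) Rspec(2)] by blast
qed
end
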